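(* Let $q$ be a power of a prime $p$, let $\mathcal{T}$ be a multiset of points of $\mathrm{AG}(2,q)$ and let $\lambda$ be an integer with $0<\lambda\le (q-1)/2$. Let $\mathcal{E}_\lambda$ be a set of $(q-\lambda)$-uniform directions w.r.t. $\mathcal{T}$, of size at most $q$, and assume that there is at least one sharply $(q-\lambda)$-uniform direction in $\mathcal{E}_\lambda$. Then the renitent lines with slope in $\mathcal{E}_\lambda$ are contained in an algebraic envelope of class $\lambda^2$ with the following properties: (1) if a direction $(u)$ of $\mathcal{E}_\lambda$ is $(q-\lambda_u)$-uniform for some $0\le\lambda_u<\lambda$, then the line pencil centered at $(u)$ is fully contained with multiplicity $(\lambda-\lambda_u)$ in the envelope; (2) pencils centered at sharply $(q-\lambda)$-uniform directions are not contained in the envelope.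
   Context: $\mathrm{AG}(2,q)$ is the desarguesian affine plane over $\mathbb{F}_q$, embedded in $\mathrm{PG}(2,q)$ as the set of points $(a:b:1)$; the line at infinity is $\ell_\infty=[0:0:1]$. Here $[u:v:w]$ denotes the line $\{(x:y:z): ux+vy+wz=0\}$. The points of $\ell_\infty$ are called directions: $(d)=(1:d:0)$ for $d\in\mathbb{F}_q$ and $(\infty)=(0:1:0)$. The affine lines with slope (direction) $d$ are the $q$ affine lines through $(d)$. Multisets are finite, and intersection sizes with $\mathcal{T}$ are counted with multiplicity. For an integer $\mu$, a direction $(d)$ is $(q-\mu)$-uniform w.r.t. $\mathcal{T}$ if at least $q-\mu$ affine lines with slope $d$ meet $\mathcal{T}$ in the same number of points modulo $p$; this number (modulo $p$) is the typical intersection number at $(d)$ (it is unique when $\mu\le (q-1)/2$). The other affine lines with slope $d$ (those whose intersection size with $\mathcal{T}$ is not congruent to the typical intersection number modulo $p$) are called renitent. A direction $(d)$ is sharply $(q-\mu)$-uniform if exactly $q-\mu$ affine lines with slope $d$ meet $\mathcal{T}$ in the typical intersection number of points modulo $p$. An algebraic envelope of class $n$ is a curve of degree $n$ in the dual plane, i.e. it is given by a nonzero homogeneous polynomial $g\in\mathbb{F}_q[U,V,W]$ of degree $n$; a line $[u:v:w]$ is contained in it if $g(u,v,w)=0$. The pencil centered at a point $P=(x:y:z)$ is the set of lines through $P$, which is the line $xU+yV+zW=0$ of the dual plane. The pencil is contained in the envelope if $xU+yV+zW$ divides $g$, and it is (fully) contained with multiplicity $k$ if $(xU+yV+zW)^k$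 divides $g$. *)

theory Defs
  imports
    "HOL-Library.Multiset"
    "HOL-Library.Cardinality"
    "HOL-Computational_Algebra.Computational_Algebra"
    "HOL-Number_Theory.Cong"
begin

text \<open>
  The field of order \<open>q\<close> is a type \<open>'a :: {field, finite}\<close> with \<open>CARD('a) = q\<close>.
  Points and lines of \<open>PG(2,q)\<close> are given by homogeneous coordinate triples, i.e. by
  representatives of \<open>(x:y:z)\<close> and \<open>[u:v:w]\<close>; points of \<open>AG(2,q)\<close> are pairs
  \<open>(a, b)\<close>, standing for \<open>(a:b:1)\<close>.
\<close>

type_synonym 'a coords = "'a \<times> 'a \<times> 'a"

definition incident :: "'a::field coords \<Rightarrow> 'a coords \<Rightarrow> bool" where
  "incident = (\<lambda>(x, y, z) (u, v, w). u * x + v * y + w * z = 0)"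

datatype 'a direction = Dir 'a | Dir_inf

fun dir_coords :: "'a::field direction \<Rightarrow> 'a coords" where
  "dir_coords (Dir d) = (1, d, 0)"
| "dir_coords Dir_inf = (0, 1, 0)"

text \<open>
  The affine part of the line \<open>[u:v:w]\<close>. Affine lines are identified with their sets of
  affine points, so that counting lines is independent of the choice of coordinates.
\<close>

definition affine_line :: "'a::field coords \<Rightarrow> ('a \<times> 'a) set" where
  "affine_line l = {(a, b). incident (a, b, 1) l}"

text \<open>
  The condition \<open>(u, v) \<noteq> (0, 0)\<close> says that \<open>[u:v:w]\<close> is a line other than the line at
  infinity \<open>[0:0:1]\<close>.
\<close>

definition affine_lines_with_slope :: "'a::field direction \<Rightarrow> ('a \<times> 'a) set set" where
  "affine_lines_with_slope d =
     {affine_line (u, v, w) | u v w. (u, v) \<noteq> (0, 0) \<and> incident (dir_coords d) (u, v, w)}"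

definition inter_size :: "('a \<times> 'a) multiset \<Rightarrow> ('a \<times> 'a) set \<Rightarrow> nat" where
  "inter_size T l = size {#P \<in># T. P \<in> l#}"

definition lines_meeting ::
    "nat \<Rightarrow> ('a::field \<times> 'a) multiset \<Rightarrow> 'a direction \<Rightarrow> nat \<Rightarrow> ('a \<times> 'a) set set" where
  "lines_meeting p T d t = {l \<in> affine_lines_with_slope d. [inter_size T l = t] (mod p)}"

text \<open>
  In the following predicates the integer \<open>mu\<close> is the parameter of
  \<open>(q - mu)\<close>-uniformity. The typical intersection number is a residue class modulo \<open>p\<close>,
  represented by any \<open>t\<close> in it; it is a relation because this class is unique only when
  \<open>mu \<le> (q - 1) / 2\<close>.
\<close>

definition typical_number ::
    "nat \<Rightarrow> ('a::{field,finite} \<times> 'a) multiset \<Rightarrow> int \<Rightarrow> 'a direction \<Rightarrow> nat \<Rightarrow> bool" where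
  "typical_number p T mu d t \<longleftrightarrow> int (card (lines_meeting p T d t)) \<ge> int CARD('a) - mu"

definition uniform_direction ::
    "nat \<Rightarrow> ('a::{field,finite} \<times> 'a) multiset \<Rightarrow> int \<Rightarrow> 'a direction \<Rightarrow> bool" where
  "uniform_direction p T mu d \<longleftrightarrow> (\<exists>t. typical_number p T mu d t)"

definition sharply_uniform_direction ::
    "nat \<Rightarrow> ('a::{field,finite} \<times> 'a) multiset \<Rightarrow> int \<Rightarrow> 'a direction \<Rightarrow> bool" where
  "sharply_uniform_direction p T mu d \<longleftrightarrow>
     (\<exists>t. typical_number p T mu d t \<and>
          int (card (lines_meeting p T d t)) = int CARD('a) - mu)"

definition renitent_line ::
    "nat \<Rightarrow> ('a::{field,finite} \<times> 'a) multiset \<Rightarrow> int \<Rightarrow> 'a direction \<Rightarrow> ('a \<times> 'a) set \<Rightarrow> bool" where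
  "renitent_line p T mu d l \<longleftrightarrow>
     l \<in> affine_lines_with_slope d \<and>
     (\<exists>t. typical_number p T mu d t \<and> \<not> [inter_size T l = t] (mod p))"

text \<open>
  The ring of polynomials in \<open>U, V, W\<close> is the iterated polynomial ring whose outermost
  variable is \<open>U\<close> and whose innermost variable is \<open>W\<close>.
\<close>

type_synonym 'a poly3 = "'a poly poly poly"

definition coeff3 :: "'a::zero poly3 \<Rightarrow> nat \<Rightarrow> nat \<Rightarrow> nat \<Rightarrow> 'a" where
  "coeff3 g i j k = coeff (coeff (coeff g i) j) k"

definition eval3 :: "'a::comm_ring_1 poly3 \<Rightarrow> 'a coords \<Rightarrow> 'a" where
  "eval3 g = (\<lambda>(u, v, w). poly (poly (poly g [:[:u:]:]) [:v:]) w)"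

definition const3 :: "'a::comm_ring_1 \<Rightarrow> 'a poly3" where
  "const3 c = [:[:[:c:]:]:]"

definition varU :: "'a::comm_ring_1 poly3" where "varU = [:0, 1:]"
definition varV :: "'a::comm_ring_1 poly3" where "varV = [:[:0, 1:]:]"
definition varW :: "'a::comm_ring_1 poly3" where "varW = [:[:[:0, 1:]:]:]"

definition homogeneous3 :: "nat \<Rightarrow> 'a::zero poly3 \<Rightarrow> bool" where
  "homogeneous3 n g \<longleftrightarrow> (\<forall>i j k. coeff3 g i j k \<noteq> 0 \<longrightarrow> i + j + k = n)"

definition algebraic_envelope :: "nat \<Rightarrow> 'a::field poly3 \<Rightarrow> bool" where
  "algebraic_envelope n g \<longleftrightarrow> g \<noteq> 0 \<and> homogeneous3 n g"

definition line_in_envelope :: "'a::field coords \<Rightarrow> 'a poly3 \<Rightarrow> bool" where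
  "line_in_envelope l g \<longleftrightarrow> eval3 g l = 0"

definition pencil_form :: "'a::field coords \<Rightarrow> 'a poly3" where
  "pencil_form = (\<lambda>(x, y, z). const3 x * varU + const3 y * varV + const3 z * varW)"

definition pencil_in_envelope :: "'a::field coords \<Rightarrow> 'a poly3 \<Rightarrow> bool" where
  "pencil_in_envelope P g \<longleftrightarrow> pencil_form P dvd g"

definition pencil_in_envelope_mult :: "nat \<Rightarrow> 'a::field coords \<Rightarrow> 'a poly3 \<Rightarrow> bool" where
  "pencil_in_envelope_mult k P g \<longleftrightarrow> pencil_form P ^ k dvd g"

lemma line_in_pencil_iff: "line_in_envelope l (pencil_form P) \<longleftrightarrow> incident P l"
  by (cases P; cases l)
     (simp add: line_in_envelope_def pencil_form_def incident_def eval3_def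
        const3_def varU_def varV_def varW_def algebra_simps)

end

theory Submission
  imports "HOL-Number_Theory.Residues" "Jordan_Normal_Form.Determinant" Defs
begin

text \<open>
  For a line direction with normal \<open>(u, v)\<close> let \<open>\<pi>\<^sub>k(u, v) = \<Sum>(u a + v b)\<^sup>k\<close>, summed over the points
  \<open>(a, b)\<close> of \<open>T\<close>. Since \<open>\<Sum>c\<^sup>k = 0\<close> over the field for \<open>k \<le> q - 2\<close>, only the lines whose
  intersection size differs from the typical number \<open>t\<close> contribute, so \<open>\<pi>\<^sub>k\<close> is the \<open>k\<close>-th power
  sum of at most \<open>\<lambda>\<close> nodes, with nonzero weights. The envelope is the determinant of the
  \<open>\<lambda> \<times> (\<lambda> + 1)\<close> Hankel matrix of \<open>\<pi>\<^sub>0, \<dots>, \<pi>\<^bsub>2\<lambda>-1\<^esub>\<close>, read as forms in \<open>U, V\<close>, bordered by the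
  row \<open>(1, -W, \<dots>, (-W)\<^sup>\<lambda>)\<close>. Its restriction to a direction with exactly \<open>\<lambda>\<close> nodes is, up to a
  nonzero constant, the polynomial whose roots are the nodes, and a direction with only
  \<open>\<mu>\<close> nodes makes the Hankel part drop to rank \<open>\<mu>\<close>, which gives the multiplicity \<open>\<lambda> - \<mu>\<close>.
  The construction is symmetric in \<open>U\<close> and \<open>V\<close>, so no direction is special.
\<close>

section \<open>Power sums over a finite field\<close>

text \<open>Replacing \<open>c\<close> by \<open>a * c\<close> for a nonzero \<open>a\<close>
  permutes the field and multiplies the sum by \<open>a ^ k\<close>, so the sum vanishes once
  \<open>a ^ k \<noteq> 1\<close>. For \<open>k > 0\<close> such an \<open>a\<close> exists because
  \<open>X^k - 1\<close> has at most \<open>k\<close> roots, fewer than there are nonzero elements.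
  For \<open>k = 0\<close> the sum is the field order, a multiple of the characteristic.\<close>

lemma sum_power_finite_field:
  fixes k :: nat
  assumes "k < CARD('a::{field,finite}) - 1"
  shows "(\<Sum>c\<in>(UNIV::'a set). c ^ k) = 0"
proof (cases "k = 0")
  case True
  then show ?thesis
    using CHAR_dvd_CARD[where 'a='a] by (simp add: of_nat_eq_0_iff_char_dvd)
next
  case False
  define f :: "'a poly" where "f = monom 1 k - 1"
  have f: "poly f a = a ^ k - 1" for a
    by (simp add: f_def poly_monom)
  have "f \<noteq> 0"
    using f[of 0] False by (auto simp: power_0_left)
  have "card {a. poly f a = 0} \<le> degree f"
    using \<open>f \<noteq> 0\<close> by (rule card_poly_roots_bound)
  also have "\<dots> \<le> k"
    unfolding f_def by (intro degree_diff_le) (auto simp: degree_monom_le)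
  also have "k < card (UNIV - {0::'a})"
    using assms by simp
  finally have "\<not> UNIV - {0} \<subseteq> {a. poly f a = 0}"
    using card_mono[of "{a. poly f a = 0}" "UNIV - {0}"] by force
  then obtain a :: 'a where a: "a \<noteq> 0" "a ^ k \<noteq> 1"
    using f by auto
  have "(\<Sum>c\<in>(UNIV::'a set). c ^ k) = (\<Sum>c\<in>UNIV. (a * c) ^ k)"
    by (rule sum.reindex_bij_witness[of _ "\<lambda>c. a * c" "\<lambda>c. c / a"]) (use a in auto)
  also have "\<dots> = a ^ k * (\<Sum>c\<in>UNIV. c ^ k)"
    by (simp add: power_mult_distrib sum_distrib_left)
  finally have "(1 - a ^ k) * (\<Sum>c\<in>(UNIV::'a set). c ^ k) = 0"
    by (simp add: algebra_simps)
  then show ?thesis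
    using a by simp
qed

lemma CHAR_eq_if_CARD_prime_power:
  assumes "prime (p::nat)" "CARD('a::{field,finite}) = p ^ h"
  shows "CHAR('a) = p"
proof -
  have "CHAR('a) > 0"
    by (rule finite_imp_CHAR_pos) simp
  then have "prime CHAR('a)"
    by (rule prime_CHAR_semidom)
  moreover have "CHAR('a) dvd p ^ h"
    using CHAR_dvd_CARD[where 'a='a] assms(2) by simp
  ultimately show ?thesis
    using assms(1) prime_dvd_power primes_dvd_imp_eq by blast
qed

lemma sum_mset_power_eq_sum_count:
  fixes \<phi> :: "'b \<Rightarrow> 'a::{comm_ring_1,finite}"
  shows "(\<Sum>P\<in>#T. \<phi> P ^ k) = (\<Sum>c\<in>UNIV. of_nat (size {#P \<in># T. \<phi> P = c#}) * c ^ k)"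
proof (induction T)
  case (add P T)
  have "(\<Sum>c\<in>UNIV. of_nat (size {#R \<in># add_mset P T. \<phi> R = c#}) * c ^ k) =
        (\<Sum>c\<in>UNIV. of_nat (size {#R \<in># T. \<phi> R = c#}) * c ^ k + (if c = \<phi> P then c ^ k else 0))"
    by (intro sum.cong) (auto simp: algebra_simps)
  then show ?case
    by (simp add: sum.distrib add)
qed simp

section \<open>Bordered Hankel determinants of weighted power sums\<close>

text \<open>If \<open>s\<close> is the moment sequence of a weight on finitely many nodes, this is
  the matrix of the classical determinant formula for the orthogonal polynomial of degree
  \<open>n\<close>, unnormalised and evaluated at \<open>x\<close>.\<close>

definition hankel_bordered :: "nat \<Rightarrow> (nat \<Rightarrow> 'a::comm_ring_1) \<Rightarrow> 'a \<Rightarrow> 'a mat" where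
  "hankel_bordered n s x =
     mat (Suc n) (Suc n) (\<lambda>(i, j). if i < n then s (i + j) else x ^ j)"

lemma hankel_bordered_carrier [simp]: "hankel_bordered n s x \<in> carrier_mat (Suc n) (Suc n)"
  by (simp add: hankel_bordered_def)

lemma (in comm_ring_hom) hom_det_hankel_bordered:
  "hom (det (hankel_bordered n s x)) = det (hankel_bordered n (\<lambda>k. hom (s k)) (hom x))"
proof -
  have "map_mat hom (hankel_bordered n s x) = hankel_bordered n (\<lambda>k. hom (s k)) (hom x)"
    by (rule eq_matI) (auto simp: hankel_bordered_def hom_power)
  then show ?thesis
    by (metis hom_det)
qed

lemma poly_eq_sum_atMost:
  fixes f :: "'a::comm_semiring_1 poly"
  assumes "degree f \<le> m"
  shows "poly f c = (\<Sum>k\<le>m. coeff f k * c ^ k)"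
  unfolding poly_altdef
  by (intro sum.mono_neutral_left) (use assms in \<open>auto simp: coeff_eq_0\<close>)

text \<open>This reads row \<open>i\<close> of a Hankel matrix, applied to the coefficient vector of
  \<open>f\<close>, as a weighted sum of the values of \<open>X^i f\<close> at the nodes. The bound
  \<open>N\<close> records how far \<open>s\<close> is known to be a power sum.\<close>

lemma sum_weighted_powers_coeff:
  fixes f :: "'a::comm_ring_1 poly"
  assumes "degree f \<le> m" and "\<And>k. k < N \<Longrightarrow> s k = (\<Sum>c\<in>S. e c * c ^ k)" and "i + m < N"
  shows "(\<Sum>k\<le>m. s (i + k) * coeff f k) = (\<Sum>c\<in>S. e c * c ^ i * poly f c)"
proof -
  have "(\<Sum>k\<le>m. s (i + k) * coeff f k) = (\<Sum>k\<le>m. \<Sum>c\<in>S. e c * c ^ i * (coeff f k * c ^ k))"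
    using assms(2,3) by (intro sum.cong) (auto simp: sum_distrib_left sum_distrib_right power_add mult_ac)
  also have "\<dots> = (\<Sum>c\<in>S. e c * c ^ i * (\<Sum>k\<le>m. coeff f k * c ^ k))"
    by (subst sum.swap) (simp add: sum_distrib_left)
  also have "\<dots> = (\<Sum>c\<in>S. e c * c ^ i * poly f c)"
    using assms(1) by (simp add: poly_eq_sum_atMost)
  finally show ?thesis .
qed

text \<open>The coefficient vector of the node polynomial \<open>f\<close> is a nonzero kernel
  vector: the Hankel rows only see its values at the nodes, and the last row evaluates it at
  \<open>x\<close>, which is itself a node.\<close>

lemma det_hankel_bordered_eq_0:
  fixes S :: "'a::field set"
  assumes fin: "finite S" and "card S \<le> n"
    and s: "\<And>k. k < 2 * n \<Longrightarrow> s k = (\<Sum>c\<in>S. e c * c ^ k)"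
    and "x \<in> S"
  shows "det (hankel_bordered n s x) = 0"
proof -
  define f :: "'a poly" where "f = (\<Prod>c\<in>S. [:-c, 1:])"
  have [simp]: "poly f c = 0 \<longleftrightarrow> c \<in> S" for c
    using fin by (simp add: f_def poly_prod)
  have "degree f = card S"
    unfolding f_def by (subst degree_prod_eq_sum_degree) auto
  then have deg: "degree f \<le> n"
    using \<open>card S \<le> n\<close> by simp
  have "f \<noteq> 0"
    using fin by (auto simp: f_def)
  define v where "v = vec (Suc n) (coeff f)"
  have v: "v \<in> carrier_vec (Suc n)"
    by (simp add: v_def)
  have "v $ degree f \<noteq> 0"
    using deg \<open>f \<noteq> 0\<close> by (simp add: v_def)
  then have "v \<noteq> 0\<^sub>v (Suc n)"
    using deg by auto
  moreover have "hankel_bordered n s x *\<^sub>v v = 0\<^sub>v (Suc n)"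
  proof (rule eq_vecI)
    fix i
    assume "i < dim_vec (0\<^sub>v (Suc n) :: 'a vec)"
    then have i: "i < Suc n"
      by simp
    show "(hankel_bordered n s x *\<^sub>v v) $ i = 0\<^sub>v (Suc n) $ i"
    proof (cases "i < n")
      case True
      then have "(hankel_bordered n s x *\<^sub>v v) $ i = (\<Sum>k\<le>n. s (i + k) * coeff f k)"
        by (simp add: hankel_bordered_def v_def scalar_prod_def atLeast0LessThan lessThan_Suc_atMost)
      also have "\<dots> = (\<Sum>c\<in>S. e c * c ^ i * poly f c)"
        using True deg s by (intro sum_weighted_powers_coeff[where N="2 * n"]) auto
      also have "\<dots> = 0"
        by (intro sum.neutral) simp
      finally show ?thesis
        using i by simp
    next
      case False
      then have "(hankel_bordered n s x *\<^sub>v v) $ i = (\<Sum>k\<le>n. x ^ k * coeff f k)"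
        using i by (simp add: hankel_bordered_def v_def scalar_prod_def atLeast0LessThan lessThan_Suc_atMost)
      also have "\<dots> = poly f x"
        using deg by (simp add: poly_eq_sum_atMost mult.commute)
      finally show ?thesis
        using i \<open>x \<in> S\<close> by simp
    qed
  qed (simp add: hankel_bordered_def)
  ultimately show ?thesis
    using v det_0_iff_vec_prod_zero_field[OF hankel_bordered_carrier] by metis
qed

text \<open>
  A kernel vector is the coefficient vector of a polynomial of degree at most \<open>n\<close>. Pairing
  the Hankel rows with Lagrange-type polynomials isolates the weight at a single node, so
  this polynomial vanishes on \<open>S\<close>; by the last row it also vanishes at \<open>x\<close>.
\<close>

lemma det_hankel_bordered_neq_0:
  fixes S :: "'a::field set"
  assumes fin: "finite S" and card: "card S = n"
    and s: "\<And>k. k < 2 * n \<Longrightarrow> s k = (\<Sum>c\<in>S. e c * c ^ k)"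
    and e: "\<And>c. c \<in> S \<Longrightarrow> e c \<noteq> 0" and "x \<notin> S"
  shows "det (hankel_bordered n s x) \<noteq> 0"
proof
  assume "det (hankel_bordered n s x) = 0"
  then obtain v where v: "v \<in> carrier_vec (Suc n)" "v \<noteq> 0\<^sub>v (Suc n)"
    and ker: "hankel_bordered n s x *\<^sub>v v = 0\<^sub>v (Suc n)"
    using det_0_iff_vec_prod_zero_field[OF hankel_bordered_carrier] by metis
  define f where "f = (\<Sum>k\<le>n. monom (v $ k) k)"
  have coeff_f: "coeff f k = (if k \<le> n then v $ k else 0)" for k
    by (auto simp: f_def coeff_sum)
  have deg: "degree f \<le> n"
    by (rule degree_le) (simp add: coeff_f)
  have ker_i: "(\<Sum>k\<le>n. (if i < n then s (i + k) else x ^ k) * coeff f k) = 0" if "i \<le> n" for i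
  proof -
    have "(hankel_bordered n s x *\<^sub>v v) $ i = (\<Sum>k\<le>n. (if i < n then s (i + k) else x ^ k) * coeff f k)"
      using v that
      by (simp add: hankel_bordered_def scalar_prod_def coeff_f atLeast0LessThan lessThan_Suc_atMost)
    then show ?thesis
      using that by (simp add: ker)
  qed
  have power: "(\<Sum>c\<in>S. e c * c ^ i * poly f c) = 0" if "i < n" for i
    using sum_weighted_powers_coeff[OF deg s, where i=i] ker_i[of i] that by simp
  have orth: "(\<Sum>c\<in>S. e c * poly f c * poly h c) = 0" if "degree h < n" for h
  proof -
    have "(\<Sum>c\<in>S. e c * poly f c * poly h c) =
        (\<Sum>c\<in>S. \<Sum>i\<le>degree h. e c * poly f c * (coeff h i * c ^ i))"
      unfolding poly_altdef[of h] sum_distrib_left ..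
    also have "\<dots> = (\<Sum>i\<le>degree h. \<Sum>c\<in>S. coeff h i * (e c * c ^ i * poly f c))"
      by (subst sum.swap) (intro sum.cong refl, simp only: mult_ac)
    also have "\<dots> = (\<Sum>i\<le>degree h. coeff h i * (\<Sum>c\<in>S. e c * c ^ i * poly f c))"
      unfolding sum_distrib_left ..
    also have "\<dots> = 0"
      using power that by (intro sum.neutral) auto
    finally show ?thesis .
  qed
  have "poly f a = 0" if "a \<in> S" for a
  proof -
    define h :: "'a poly" where "h = (\<Prod>c\<in>S - {a}. [:-c, 1:])"
    have "degree h = card (S - {a})"
      unfolding h_def by (subst degree_prod_eq_sum_degree) auto
    then have "degree h < n"
      using fin card that by (metis card_Diff1_less)
    have h: "poly h c = 0 \<longleftrightarrow> c \<in> S - {a}" for c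
      using fin by (simp add: h_def poly_prod)
    have "0 = (\<Sum>c\<in>S. e c * poly f c * poly h c)"
      using orth[OF \<open>degree h < n\<close>] by simp
    also have "\<dots> = (\<Sum>c\<in>{a}. e c * poly f c * poly h c)"
      using fin that h by (intro sum.mono_neutral_right) auto
    finally show ?thesis
      using e[OF that] h[of a] by simp
  qed
  moreover have "poly f x = 0"
    using ker_i[of n] deg by (simp add: poly_eq_sum_atMost mult.commute)
  \<comment> \<open>Now \<open>f\<close> has \<open>n + 1\<close> distinct roots but degree at most
    \<open>n\<close>.\<close>
  ultimately have "insert x S \<subseteq> {c. poly f c = 0}"
    by auto
  moreover have "f \<noteq> 0"
  proof
    assume "f = 0"
    then have "v $ k = 0" if "k \<le> n" for k
      using coeff_f[of k] that by simp
    then have "v = 0\<^sub>v (Suc n)"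
      using v by (intro eq_vecI) auto
    with v show False
      by simp
  qed
  ultimately have "card (insert x S) \<le> degree f"
    using card_mono[OF poly_roots_finite] card_poly_roots_bound le_trans by blast
  then show False
    using deg fin card \<open>x \<notin> S\<close> by simp
qed

text \<open>In each Leibniz term at most \<open>m\<close> of the first \<open>n\<close> rows can use
  one of the columns below \<open>m\<close>. The other rows, at least \<open>n - m\<close> of them,
  each contribute a factor divisible by \<open>L\<close>.\<close>

lemma power_dvd_det:
  fixes A :: "'a::comm_ring_1 mat"
  assumes A: "A \<in> carrier_mat (Suc n) (Suc n)"
    and dvd: "\<And>i j. i < n \<Longrightarrow> m \<le> j \<Longrightarrow> j \<le> n \<Longrightarrow> L dvd A $$ (i, j)"
  shows "L ^ (n - m) dvd det A"
  unfolding det_def'[OF A]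
proof (intro dvd_sum dvd_mult)
  fix \<pi>
  assume "\<pi> \<in> {\<pi>. \<pi> permutes {0..<Suc n}}"
  then have \<pi>: "\<pi> permutes {0..<Suc n}"
    by simp
  define I where "I = {i. i < n \<and> m \<le> \<pi> i}"
  have "{..<n} - I \<subseteq> \<pi> -` {..<m}"
    by (auto simp: I_def)
  then have "card ({..<n} - I) \<le> card {..<m}"
    using permutes_inj_on[OF \<pi>] by (intro card_inj_on_le[of \<pi>]) auto
  moreover have "card ({..<n} - I) = n - card I"
    by (subst card_Diff_subset) (auto simp: I_def)
  ultimately have "n - m \<le> card I"
    by simp
  then have "L ^ (n - m) dvd (\<Prod>i\<in>I. L)"
    by (simp add: le_imp_power_dvd)
  also have "(\<Prod>i\<in>I. L) dvd (\<Prod>i\<in>I. A $$ (i, \<pi> i))"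
    using permutes_in_image[OF \<pi>] by (intro prod_dvd_prod dvd) (auto simp: I_def less_Suc_eq_le)
  also have "\<dots> dvd (\<Prod>i = 0..<Suc n. A $$ (i, \<pi> i))"
    by (rule prod_dvd_prod_subset) (auto simp: I_def)
  finally show "L ^ (n - m) dvd (\<Prod>i = 0..<Suc n. A $$ (i, \<pi> i))" .
qed

text \<open>
  Column operations with the upper unitriangular matrix of the \<open>C k j\<close> make the upper parts
  of the columns \<open>m, \<dots>, n\<close> divisible by \<open>L\<close>.
\<close>

lemma power_dvd_det_hankel_bordered:
  fixes s :: "nat \<Rightarrow> 'a::comm_ring_1"
  assumes C: "\<And>j. j \<le> n \<Longrightarrow> C j j = 1"
    and dvd: "\<And>i j. i < n \<Longrightarrow> m \<le> j \<Longrightarrow> j \<le> n \<Longrightarrow> L dvd (\<Sum>k\<le>j. s (i + k) * C k j)"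
  shows "L ^ (n - m) dvd det (hankel_bordered n s x)"
proof -
  define U where "U = mat (Suc n) (Suc n) (\<lambda>(k, j). if k \<le> j then C k j else 0)"
  have U: "U \<in> carrier_mat (Suc n) (Suc n)"
    by (simp add: U_def)
  have "det U = prod_list (diag_mat U)"
    by (rule det_upper_triangular[OF _ U]) (auto simp: U_def)
  also have "diag_mat U = replicate (Suc n) 1"
    using C by (intro nth_equalityI) (auto simp: diag_mat_def U_def simp del: replicate_Suc upt_Suc)
  finally have "det U = 1"
    by simp
  have "L ^ (n - m) dvd det (hankel_bordered n s x * U)"
  proof (rule power_dvd_det)
    fix i j
    assume ij: "i < n" "m \<le> j" "j \<le> n"
    have "(hankel_bordered n s x * U) $$ (i, j) =
        (\<Sum>k\<le>n. s (i + k) * (if k \<le> j then C k j else 0))"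
      using ij by (simp add: hankel_bordered_def U_def scalar_prod_def atLeast0LessThan lessThan_Suc_atMost)
    also have "\<dots> = (\<Sum>k\<le>j. s (i + k) * C k j)"
      using ij by (intro sum.mono_neutral_cong_right) auto
    finally show "L dvd (hankel_bordered n s x * U) $$ (i, j)"
      using dvd[OF ij] by simp
  qed (rule mult_carrier_mat[OF hankel_bordered_carrier U])
  then show ?thesis
    using U by (simp add: det_mult[where n="Suc n"] \<open>det U = 1\<close>)
qed

section \<open>Affine lines of a given slope\<close>

lemma affine_line_eq: "affine_line (u, v, w) = {P. u * fst P + v * snd P = - w}"
  by (auto simp: affine_line_def incident_def eq_neg_iff_add_eq_0)

lemma affine_line_not_empty:
  assumes "(u, v) \<noteq> (0, 0)"
  shows "affine_line (u, v, w) \<noteq> {}"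
proof (cases "u = 0")
  case True
  then have "(0, - w / v) \<in> affine_line (u, v, w)"
    using assms by (simp add: affine_line_eq)
  then show ?thesis
    by blast
next
  case False
  then have "(- w / u, 0) \<in> affine_line (u, v, w)"
    by (simp add: affine_line_eq)
  then show ?thesis
    by blast
qed

lemma incident_dir_coords_cong:
  "incident (dir_coords d) (u, v, w) \<longleftrightarrow> incident (dir_coords d) (u, v, w')"
  by (cases d) (auto simp: incident_def)

text \<open>The normals of the lines through a fixed point at infinity form a one-dimensional
  space.\<close>

lemma incident_dir_coords_proportional:
  assumes "incident (dir_coords d) (u, v, w)" "incident (dir_coords d) (u', v', w')"
    and "(u, v) \<noteq> (0, 0)" "(u', v') \<noteq> (0, 0)"
  obtains r where "r \<noteq> 0" "u' = r * u" "v' = r * v"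
proof (cases d)
  case (Dir m)
  then have "u = - (v * m)" "u' = - (v' * m)"
    using assms by (auto simp: incident_def eq_neg_iff_add_eq_0)
  then show ?thesis
    using that[of "v' / v"] assms by auto
next
  case Dir_inf
  then have "v = 0" "v' = 0"
    using assms by (auto simp: incident_def)
  then show ?thesis
    using that[of "u' / u"] assms by auto
qed

lemma affine_line_in_slope_iff:
  assumes "(u, v) \<noteq> (0, 0)"
  shows "affine_line (u, v, w) \<in> affine_lines_with_slope d \<longleftrightarrow> incident (dir_coords d) (u, v, w)"
proof
  assume "affine_line (u, v, w) \<in> affine_lines_with_slope d"
  then obtain u' v' w' where eq: "affine_line (u, v, w) = affine_line (u', v', w')"
    and inc: "incident (dir_coords d) (u', v', w')"
    by (auto simp: affine_lines_with_slope_def)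
  obtain x y where d: "dir_coords d = (x, y, 0)"
    by (cases d) auto
  obtain a b where ab: "(a, b) \<in> affine_line (u, v, w)"
    using affine_line_not_empty[OF assms] by fastforce
  \<comment> \<open>Translation by the direction vector preserves the line. This recovers the slope
    from the mere set of affine points.\<close>
  then have "(a + x, b + y) \<in> affine_line (u', v', w')"
    using inc d unfolding eq by (simp add: affine_line_eq incident_def algebra_simps)
  then have "(u * a + v * b) + (u * x + v * y) = - w"
    unfolding eq[symmetric] by (simp add: affine_line_eq algebra_simps)
  then show "incident (dir_coords d) (u, v, w)"
    using ab by (simp add: d incident_def affine_line_eq)
qed (use assms in \<open>auto simp: affine_lines_with_slope_def\<close>)

text \<open>Once the normal \<open>(u, v)\<close> is fixed, the lines of this slope are the level
  sets of \<open>u a + v b\<close>. The sign in \<open>- c\<close> makes \<open>c\<close> the value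
  on the line, so that lines can be treated as nodes in the field.\<close>

lemma bij_betw_affine_lines_with_slope:
  assumes uv: "(u, v) \<noteq> (0, 0)" and inc: "incident (dir_coords d) (u, v, 0)"
  shows "bij_betw (\<lambda>c. affine_line (u, v, - c)) UNIV (affine_lines_with_slope d)"
proof (rule bij_betw_imageI)
  show "inj (\<lambda>c. affine_line (u, v, - c))"
  proof (rule injI)
    fix c c'
    assume eq: "affine_line (u, v, - c) = affine_line (u, v, - c')"
    obtain P where "P \<in> affine_line (u, v, - c)"
      using affine_line_not_empty[OF uv] by blast
    moreover from this have "P \<in> affine_line (u, v, - c')"
      unfolding eq .
    ultimately show "c = c'"
      by (simp add: affine_line_eq)
  qed
  show "range (\<lambda>c. affine_line (u, v, - c)) = affine_lines_with_slope d"
  proof (intro equalityI subsetI)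
    fix l
    assume "l \<in> affine_lines_with_slope d"
    then obtain u' v' w' where l: "l = affine_line (u', v', w')" "(u', v') \<noteq> (0, 0)"
      and inc': "incident (dir_coords d) (u', v', w')"
      by (auto simp: affine_lines_with_slope_def)
    obtain r where r: "r \<noteq> 0" "u' = r * u" "v' = r * v"
      using incident_dir_coords_proportional[OF inc inc' uv l(2)] .
    have "u' * a + v' * b = - w' \<longleftrightarrow> u * a + v * b = - (w' / r)" for a b
      using r by (auto simp: field_simps)
    then have "l = affine_line (u, v, - (- (w' / r)))"
      by (auto simp: l affine_line_eq)
    then show "l \<in> range (\<lambda>c. affine_line (u, v, - c))"
      by blast
  next
    fix l
    assume "l \<in> range (\<lambda>c. affine_line (u, v, - c))"
    then show "l \<in> affine_lines_with_slope d"
      using affine_line_in_slope_iff[OF uv] inc incident_dir_coords_cong by blast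
  qed
qed

section \<open>Power sums of a multiset along a direction\<close>

definition moment :: "('a \<times> 'a) multiset \<Rightarrow> 'a \<Rightarrow> 'a \<Rightarrow> nat \<Rightarrow> 'a::comm_ring_1" where
  "moment T u v k = (\<Sum>P\<in>#T. (u * fst P + v * snd P) ^ k)"

text \<open>
  The weights are supported on the lines whose intersection size is not \<open>t\<close> modulo \<open>p\<close>, because
  subtracting the constant \<open>t\<close> from all multiplicities does not change the power sums of low
  degree.
\<close>

lemma moment_eq_weighted_power_sum:
  fixes T :: "('a::{field,finite} \<times> 'a) multiset" and t :: nat
  defines "e \<equiv> \<lambda>u v c. of_nat (inter_size T (affine_line (u, v, - c))) - of_nat t :: 'a"
  assumes "k < CARD('a) - 1"
  shows "moment T u v k = (\<Sum>c | e u v c \<noteq> 0. e u v c * c ^ k)"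
proof -
  have "moment T u v k = (\<Sum>c\<in>UNIV. of_nat (inter_size T (affine_line (u, v, - c))) * c ^ k)"
    unfolding moment_def sum_mset_power_eq_sum_count by (simp add: inter_size_def affine_line_eq)
  also have "\<dots> = (\<Sum>c\<in>UNIV. e u v c * c ^ k) + of_nat t * (\<Sum>c\<in>UNIV. c ^ k)"
    by (simp add: e_def algebra_simps sum_distrib_left flip: sum.distrib)
  also have "\<dots> = (\<Sum>c\<in>UNIV. e u v c * c ^ k)"
    using assms by (simp add: sum_power_finite_field)
  also have "\<dots> = (\<Sum>c | e u v c \<noteq> 0. e u v c * c ^ k)"
    by (rule sum.mono_neutral_right) auto
  finally show ?thesis .
qed

text \<open>In characteristic \<open>p\<close>, a difference of naturals vanishes in the field
  exactly when they are congruent modulo \<open>p\<close>. Hence the support of the weights is the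
  complement of the values \<open>c\<close> of the lines with intersection number
  \<open>t\<close>.\<close>

lemma card_atypical_add_card_lines_meeting:
  fixes T :: "('a::{field,finite} \<times> 'a) multiset" and t :: nat
  assumes p: "CHAR('a) = p" and uv: "(u, v) \<noteq> (0, 0)" and inc: "incident (dir_coords d) (u, v, 0)"
  shows "card {c. of_nat (inter_size T (affine_line (u, v, - c))) - of_nat t \<noteq> (0::'a)} +
    card (lines_meeting p T d t) = CARD('a)"
proof -
  let ?l = "\<lambda>c. affine_line (u, v, - c)"
  let ?A = "{c. of_nat (inter_size T (?l c)) - of_nat t \<noteq> (0::'a)}"
  note bij = bij_betw_affine_lines_with_slope[OF uv inc]
  have "?A = {c. \<not> [inter_size T (?l c) = t] (mod p)}"
    using p by (auto simp: of_nat_eq_iff_cong_CHAR)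
  moreover have "lines_meeting p T d t = {l \<in> range ?l. [inter_size T l = t] (mod p)}"
    by (simp add: lines_meeting_def bij_betw_imp_surj_on[OF bij])
  ultimately have "lines_meeting p T d t = ?l ` (- ?A)"
    by auto
  then have "card (lines_meeting p T d t) = card (- ?A)"
    using card_image[OF inj_on_subset[OF bij_betw_imp_inj_on[OF bij] subset_UNIV]] by simp
  then show ?thesis
    using card_Un_disjoint[of ?A "- ?A"] by simp
qed

lemma typical_number_iff:
  fixes T :: "('a::{field,finite} \<times> 'a) multiset" and t mu :: nat
  assumes "CHAR('a) = p" "(u, v) \<noteq> (0, 0)" "incident (dir_coords d) (u, v, 0)"
  shows "typical_number p T (int mu) d t \<longleftrightarrow>
    card {c. of_nat (inter_size T (affine_line (u, v, - c))) - of_nat t \<noteq> (0::'a)} \<le> mu"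
  using card_atypical_add_card_lines_meeting[OF assms, of T t]
  by (auto simp: typical_number_def simp del: right_minus_eq)

section \<open>Homogeneous polynomials in three variables\<close>

lemma homogeneous3_0: "homogeneous3 n 0"
  by (simp add: homogeneous3_def coeff3_def)

lemma homogeneous3_add: "homogeneous3 n f \<Longrightarrow> homogeneous3 n g \<Longrightarrow> homogeneous3 n (f + g)"
  by (auto simp: homogeneous3_def coeff3_def) (metis add_0)

lemma homogeneous3_uminus: "homogeneous3 n f \<Longrightarrow> homogeneous3 n (- f :: 'a::ab_group_add poly3)"
  by (simp add: homogeneous3_def coeff3_def)

lemma homogeneous3_sum: "(\<And>x. x \<in> A \<Longrightarrow> homogeneous3 n (f x)) \<Longrightarrow> homogeneous3 n (sum f A)"
  by (induction A rule: infinite_finite_induct) (auto simp: homogeneous3_0 homogeneous3_add)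

lemma homogeneous3_sum_mset: "(\<And>x. x \<in># A \<Longrightarrow> homogeneous3 n (f x)) \<Longrightarrow> homogeneous3 n (\<Sum>x\<in>#A. f x)"
  by (induction A) (auto simp: homogeneous3_0 homogeneous3_add)

lemma homogeneous3_mult:
  fixes f g :: "'a::comm_ring_1 poly3"
  assumes f: "homogeneous3 m f" and g: "homogeneous3 n g"
  shows "homogeneous3 (m + n) (f * g)"
  unfolding homogeneous3_def
proof (intro allI impI)
  fix i j k
  have "coeff3 (f * g) i j k =
      (\<Sum>i'\<le>i. \<Sum>j'\<le>j. \<Sum>k'\<le>k. coeff3 f i' j' k' * coeff3 g (i - i') (j - j') (k - k'))"
    by (simp add: coeff3_def coeff_mult coeff_sum)
  moreover assume "coeff3 (f * g) i j k \<noteq> 0"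
  ultimately obtain i' j' k' where le: "i' \<le> i" "j' \<le> j" "k' \<le> k"
    and "coeff3 f i' j' k' * coeff3 g (i - i') (j - j') (k - k') \<noteq> 0"
    by (auto elim!: sum.not_neutral_contains_not_neutral)
  then have "coeff3 f i' j' k' \<noteq> 0" "coeff3 g (i - i') (j - j') (k - k') \<noteq> 0"
    by auto
  then have "i' + j' + k' = m" "(i - i') + (j - j') + (k - k') = n"
    using f g unfolding homogeneous3_def by blast+
  then show "i + j + k = m + n"
    using le by linarith
qed

lemma homogeneous3_1: "homogeneous3 0 (1 :: 'a::comm_ring_1 poly3)"
  by (auto simp: homogeneous3_def coeff3_def coeff_1 split: if_splits)

lemma homogeneous3_prod:
  fixes f :: "'b \<Rightarrow> 'a::comm_ring_1 poly3"
  shows "(\<And>x. x \<in> A \<Longrightarrow> homogeneous3 (d x) (f x)) \<Longrightarrow> homogeneous3 (sum d A) (prod f A)"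
  by (induction A rule: infinite_finite_induct) (auto simp: homogeneous3_1 homogeneous3_mult)

lemma homogeneous3_power:
  fixes f :: "'a::comm_ring_1 poly3"
  shows "homogeneous3 n f \<Longrightarrow> homogeneous3 (n * k) (f ^ k)"
  by (induction k) (auto simp: homogeneous3_1 homogeneous3_mult)

lemma homogeneous3_const3: "homogeneous3 0 (const3 c)"
  by (auto simp: homogeneous3_def coeff3_def const3_def coeff_pCons split: nat.splits)

lemma homogeneous3_var:
  "homogeneous3 1 (varU :: 'a::comm_ring_1 poly3)"
  "homogeneous3 1 (varV :: 'a::comm_ring_1 poly3)"
  "homogeneous3 1 (varW :: 'a::comm_ring_1 poly3)"
  by (auto simp: homogeneous3_def coeff3_def varU_def varV_def varW_def coeff_pCons
      split: nat.splits if_splits)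

text \<open>With degrees split into row weights \<open>r\<close> and column weights
  \<open>c\<close>, every permutation collects the same total, so all Leibniz terms have the same
  degree.\<close>

lemma homogeneous3_det:
  fixes A :: "'a::comm_ring_1 poly3 mat"
  assumes A: "A \<in> carrier_mat n n"
    and hom: "\<And>i j. i < n \<Longrightarrow> j < n \<Longrightarrow> homogeneous3 (r i + c j) (A $$ (i, j))"
  shows "homogeneous3 (sum r {0..<n} + sum c {0..<n}) (det A)"
  unfolding det_def'[OF A]
proof (rule homogeneous3_sum)
  fix \<pi>
  assume "\<pi> \<in> {\<pi>. \<pi> permutes {0..<n}}"
  then have \<pi>: "\<pi> permutes {0..<n}"
    by simp
  have "homogeneous3 (\<Sum>i = 0..<n. r i + c (\<pi> i)) (\<Prod>i = 0..<n. A $$ (i, \<pi> i))"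
    by (intro homogeneous3_prod hom) (use permutes_in_image[OF \<pi>] in auto)
  also have "(\<Sum>i = 0..<n. r i + c (\<pi> i)) = sum r {0..<n} + sum c {0..<n}"
    using sum.permute[OF \<pi>, of c] by (simp add: sum.distrib o_def)
  finally show "homogeneous3 (sum r {0..<n} + sum c {0..<n})
      (signof \<pi> * (\<Prod>i = 0..<n. A $$ (i, \<pi> i)))"
    by (auto simp: sign_def homogeneous3_uminus)
qed

lemma eval3_hom: "comm_ring_hom (\<lambda>g :: 'a::comm_ring_1 poly3. eval3 g l)"
  by (cases l; unfold_locales) (auto simp: eval3_def)

lemma const3_hom: "comm_ring_hom (const3 :: 'a::comm_ring_1 \<Rightarrow> _)"
  by unfold_locales (auto simp: const3_def one_pCons)

section \<open>The envelope\<close>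

definition moment_form :: "('a \<times> 'a) multiset \<Rightarrow> nat \<Rightarrow> 'a::comm_ring_1 poly3" where
  "moment_form T k = (\<Sum>P\<in>#T. (const3 (fst P) * varU + const3 (snd P) * varV) ^ k)"

text \<open>The border uses \<open>- varW\<close> because \<open>u a + v b = - w\<close> on the
  affine part of the line \<open>[u:v:w]\<close>, so evaluation at a line inserts its own node
  value.\<close>

definition renitent_envelope :: "nat \<Rightarrow> ('a \<times> 'a) multiset \<Rightarrow> 'a::comm_ring_1 poly3" where
  "renitent_envelope n T = det (hankel_bordered n (moment_form T) (- varW))"

lemma eval3_renitent_envelope:
  "eval3 (renitent_envelope n T) (u, v, w) = det (hankel_bordered n (moment T u v) (- w))"
proof -
  interpret comm_ring_hom "\<lambda>g. eval3 g (u, v, w)"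
    by (rule eval3_hom)
  have vars: "eval3 varU (u, v, w) = u" "eval3 varV (u, v, w) = v" "eval3 varW (u, v, w) = w"
    "eval3 (const3 c) (u, v, w) = c" for c
    by (simp_all add: eval3_def varU_def varV_def varW_def const3_def)
  have "eval3 (moment_form T k) (u, v, w) = moment T u v k" for k
    by (induction T)
      (simp_all add: moment_form_def moment_def hom_add hom_mult hom_power vars mult.commute)
  then show ?thesis
    by (simp add: renitent_envelope_def hom_det_hankel_bordered hom_uminus vars)
qed

text \<open>Entry \<open>(i, j)\<close> has degree \<open>i + j\<close> in a Hankel row and
  \<open>j\<close> in the border, so the degrees add up to
  \<open>n(n-1)/2 + n(n+1)/2\<close>.\<close>

lemma homogeneous3_renitent_envelope:
  fixes T :: "('a::comm_ring_1 \<times> 'a) multiset"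
  shows "homogeneous3 (n ^ 2) (renitent_envelope n T)"
proof -
  define r where "r i = (if i < n then i else 0)" for i
  have mf: "homogeneous3 k (moment_form T k)" for k
  proof -
    have "homogeneous3 (0 + 1) (const3 a * varU + const3 b * varV)" for a b :: 'a
      by (intro homogeneous3_add homogeneous3_mult homogeneous3_const3 homogeneous3_var)
    then show ?thesis
      unfolding moment_form_def using homogeneous3_power[where n=1]
      by (intro homogeneous3_sum_mset) auto
  qed
  have "homogeneous3 (sum r {0..<Suc n} + sum (\<lambda>j. j) {0..<Suc n}) (renitent_envelope n T)"
    unfolding renitent_envelope_def
  proof (rule homogeneous3_det)
    fix i j
    assume "i < Suc n" "j < Suc n"
    moreover have "homogeneous3 (1 * j) ((- varW :: 'a poly3) ^ j)"
      by (intro homogeneous3_power homogeneous3_uminus homogeneous3_var)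
    ultimately show "homogeneous3 (r i + j) (hankel_bordered n (moment_form T) (- varW) $$ (i, j))"
      using mf
      by (simp add: hankel_bordered_def r_def)
  qed simp
  moreover have "sum r {0..<Suc n} + sum (\<lambda>j. j) {0..<Suc n} = n ^ 2"
  proof -
    have "sum r {0..<Suc n} = \<Sum>{0..<n}"
      by (simp add: r_def)
    moreover have "\<Sum>{0..<n} + \<Sum>{0..<n} + n = n ^ 2"
      by (induction n) (auto simp: power2_eq_square)
    ultimately show ?thesis
      by simp
  qed
  ultimately show ?thesis
    by simp
qed

text \<open>
  \<open>N\<close> is the remaining coordinate on the pencil, so that modulo the form of the pencil
  \<open>(U, V)\<close> becomes \<open>(u N, v N)\<close>.
\<close>

lemma moment_form_cong_pencil:
  fixes T :: "('a::field \<times> 'a) multiset"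
  obtains u v N where "(u, v) \<noteq> (0, 0)" "incident (dir_coords d) (u, v, 0)"
    "\<And>k. pencil_form (dir_coords d) dvd moment_form T k - const3 (moment T u v k) * N ^ k"
proof -
  interpret const: comm_ring_hom "const3 :: 'a \<Rightarrow> _"
    by (rule const3_hom)
  let ?L = "pencil_form (dir_coords d)"
  have "\<exists>u v N. (u, v) \<noteq> (0, 0) \<and> incident (dir_coords d) (u, v, 0) \<and>
    ?L dvd varU - const3 u * N \<and> ?L dvd varV - const3 v * N"
  proof (cases d)
    \<comment> \<open>Here the pencil form is \<open>U + m V\<close>, so \<open>U\<close> is
      congruent to \<open>- m V\<close> and \<open>V\<close> serves as \<open>N\<close>. At
      \<open>Dir_inf\<close> the form is \<open>V\<close>, and \<open>U\<close> serves as
      \<open>N\<close>.\<close>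
    case (Dir m)
    then show ?thesis
      by (intro exI[of _ "- m"] exI[of _ 1] exI[of _ varV])
        (simp add: incident_def pencil_form_def const.hom_uminus algebra_simps)
  next
    case Dir_inf
    then show ?thesis
      by (intro exI[of _ 1] exI[of _ 0] exI[of _ varU])
        (simp add: incident_def pencil_form_def)
  qed
  then obtain u v N where uv: "(u, v) \<noteq> (0, 0)" "incident (dir_coords d) (u, v, 0)"
    and U: "?L dvd varU - const3 u * N" and V: "?L dvd varV - const3 v * N"
    by blast
  have form: "?L dvd (const3 a * varU + const3 b * varV) ^ k - const3 ((u * a + v * b) ^ k) * N ^ k"
    for a b k
  proof -
    let ?A = "const3 a * varU + const3 b * varV" and ?B = "const3 (u * a + v * b) * N"
    have "?A - ?B = const3 a * (varU - const3 u * N) + const3 b * (varV - const3 v * N)"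
      by (simp add: const.hom_add const.hom_mult algebra_simps)
    then have "?L dvd ?A - ?B"
      using U V by simp
    also have "?A - ?B dvd ?A ^ k - ?B ^ k"
      unfolding power_diff_sumr2 by (rule dvd_triv_left)
    finally show ?thesis
      by (simp add: const.hom_power power_mult_distrib)
  qed
  have "?L dvd moment_form T k - const3 (moment T u v k) * N ^ k" for k
  proof (induction T)
    case (add P T)
    have "moment_form (add_mset P T) k - const3 (moment (add_mset P T) u v k) * N ^ k =
      ((const3 (fst P) * varU + const3 (snd P) * varV) ^ k - const3 ((u * fst P + v * snd P) ^ k) * N ^ k)
      + (moment_form T k - const3 (moment T u v k) * N ^ k)"
      by (simp add: moment_form_def moment_def const.hom_add algebra_simps)
    then show ?case
      using form add by simp
  qed (simp add: moment_form_def moment_def)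
  with uv show ?thesis
    using that by blast
qed

text \<open>Modulo the pencil form the moments become power sums over the nodes \<open>S\<close>, up
  to powers of \<open>N\<close>. Any polynomial vanishing on \<open>S\<close> then gives a
  combination of columns whose Hankel part is zero modulo that form, and there is a monic one in
  each degree from \<open>card S\<close> to \<open>n\<close>.\<close>

lemma pencil_power_dvd_renitent_envelope:
  fixes T :: "('a::{field,finite} \<times> 'a) multiset"
  assumes p: "CHAR('a) = p" and n: "2 * n < CARD('a)"
    and "uniform_direction p T (int mu) d"
  shows "pencil_in_envelope_mult (n - mu) (dir_coords d) (renitent_envelope n T)"
proof -
  interpret const: comm_ring_hom "const3 :: 'a \<Rightarrow> _"
    by (rule const3_hom)
  let ?L = "pencil_form (dir_coords d) :: 'a poly3"
  obtain u v N where uv: "(u, v) \<noteq> (0, 0)" "incident (dir_coords d) (u, v, 0)"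
    and mf: "\<And>k. ?L dvd moment_form T k - const3 (moment T u v k) * N ^ k"
    using moment_form_cong_pencil[of d T] by metis
  obtain t where t: "typical_number p T (int mu) d t"
    using assms by (auto simp: uniform_direction_def)
  define e where "e c = of_nat (inter_size T (affine_line (u, v, - c))) - (of_nat t :: 'a)" for c
  define S where "S = {c. e c \<noteq> 0}"
  have card_S: "card S \<le> mu"
    using t typical_number_iff[OF p uv] by (simp add: S_def e_def)
  have mom: "moment T u v k = (\<Sum>c\<in>S. e c * c ^ k)" if "k < 2 * n" for k
    using moment_eq_weighted_power_sum[of k T u v t] n that by (simp add: S_def e_def)
  define f :: "nat \<Rightarrow> 'a poly" where "f j = (\<Prod>c\<in>S. [:-c, 1:]) * monom 1 (j - card S)" for j
  have deg_S: "degree (\<Prod>c\<in>S. [:-c, 1:]) = card S"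
    by (subst degree_prod_eq_sum_degree) auto
  have lc_S: "lead_coeff (\<Prod>c\<in>S. [:-c, 1:]) = 1"
    by (simp add: lead_coeff_prod)
  have deg: "degree (f j) = j" and lc: "coeff (f j) j = 1" if "card S \<le> j" for j
  proof -
    have "(\<Prod>c\<in>S. [:-c, 1:]) \<noteq> 0"
      by auto
    then show d: "degree (f j) = j"
      using that unfolding f_def by (subst degree_mult_eq) (auto simp: deg_S degree_monom_eq)
    have "lead_coeff (f j) = 1"
      unfolding f_def lead_coeff_mult lc_S by (simp add: degree_monom_eq)
    then show "coeff (f j) j = 1"
      by (simp add: d)
  qed
  have roots: "poly (f j) c = 0" if "c \<in> S" for c j
    using that by (simp add: f_def poly_prod)
  \<comment> \<open>The power of \<open>N\<close> homogenises the coefficients, so that all terms in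
    a column sum carry \<open>N ^ (i + j)\<close>. In columns below \<open>card S\<close> only the
    diagonal value 1 matters, and the default 1 supplies it.\<close>
  define C where "C k j = (if card S \<le> j then const3 (coeff (f j) k) * N ^ (j - k) else 1)" for k j
  have "?L ^ (n - card S) dvd renitent_envelope n T"
    unfolding renitent_envelope_def
  proof (rule power_dvd_det_hankel_bordered)
    show "C j j = 1" for j
      by (simp add: C_def lc)
  next
    fix i j
    assume ij: "i < n" "card S \<le> j" "j \<le> n"
    have "(\<Sum>k\<le>j. moment T u v (i + k) * coeff (f j) k) = (\<Sum>c\<in>S. e c * c ^ i * poly (f j) c)"
      using ij deg mom by (intro sum_weighted_powers_coeff[where N="2 * n"]) auto
    also have "\<dots> = 0"
      by (intro sum.neutral) (simp add: roots)
    finally have sum0: "(\<Sum>k\<le>j. moment T u v (i + k) * coeff (f j) k) = 0" .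
    have "(\<Sum>k\<le>j. const3 (moment T u v (i + k)) * N ^ (i + k) * C k j) =
        (\<Sum>k\<le>j. const3 (moment T u v (i + k) * coeff (f j) k) * N ^ (i + j))"
    proof (intro sum.cong refl)
      fix k
      assume "k \<in> {..j}"
      then have "N ^ (i + j) = N ^ (i + k) * N ^ (j - k)"
        by (simp flip: power_add)
      then show "const3 (moment T u v (i + k)) * N ^ (i + k) * C k j =
          const3 (moment T u v (i + k) * coeff (f j) k) * N ^ (i + j)"
        using ij by (simp add: C_def const.hom_mult mult_ac)
    qed
    also have "\<dots> = const3 (\<Sum>k\<le>j. moment T u v (i + k) * coeff (f j) k) * N ^ (i + j)"
      by (simp add: const.hom_sum sum_distrib_right)
    also have "\<dots> = 0"
      by (simp add: sum0)
    \<comment> \<open>Subtracting a sum that is zero leaves summands that are divisible by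
      \<open>?L\<close> one by one.\<close>
    finally have "(\<Sum>k\<le>j. moment_form T (i + k) * C k j) =
        (\<Sum>k\<le>j. (moment_form T (i + k) - const3 (moment T u v (i + k)) * N ^ (i + k)) * C k j)"
      by (simp add: algebra_simps sum_subtractf)
    also have "?L dvd \<dots>"
      by (intro dvd_sum dvd_mult2 mf)
    finally show "?L dvd (\<Sum>k\<le>j. moment_form T (i + k) * C k j)" .
  qed
  moreover have "?L ^ (n - mu) dvd ?L ^ (n - card S)"
    using card_S by (intro le_imp_power_dvd) simp
  ultimately show ?thesis
    unfolding pencil_in_envelope_mult_def by (rule dvd_trans[rotated])
qed

text \<open>Being renitent means that the value \<open>- w\<close> of the line is one of the at most
  \<open>n\<close> nodes of its direction, and the bordered determinant vanishes at nodes.\<close>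

lemma renitent_line_in_envelope:
  fixes T :: "('a::{field,finite} \<times> 'a) multiset"
  assumes p: "CHAR('a) = p" and n: "2 * n < CARD('a)" and uv: "(u, v) \<noteq> (0, 0)"
    and ren: "renitent_line p T (int n) d (affine_line (u, v, w))"
  shows "line_in_envelope (u, v, w) (renitent_envelope n T)"
proof -
  obtain t where t: "typical_number p T (int n) d t"
    and w: "\<not> [inter_size T (affine_line (u, v, w)) = t] (mod p)"
    using ren by (auto simp: renitent_line_def)
  have inc: "incident (dir_coords d) (u, v, 0)"
    using ren affine_line_in_slope_iff[OF uv] incident_dir_coords_cong[of d u v w 0]
    by (simp add: renitent_line_def)
  define e where "e c = of_nat (inter_size T (affine_line (u, v, - c))) - (of_nat t :: 'a)" for c
  have "det (hankel_bordered n (moment T u v) (- w)) = 0"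
  proof (rule det_hankel_bordered_eq_0)
    show "card {c. e c \<noteq> 0} \<le> n"
      using t typical_number_iff[OF p uv inc] by (simp add: e_def)
    show "moment T u v k = (\<Sum>c | e c \<noteq> 0. e c * c ^ k)" if "k < 2 * n" for k
      using moment_eq_weighted_power_sum[of k T u v t] n that by (simp add: e_def)
    show "- w \<in> {c. e c \<noteq> 0}"
      using w p by (simp add: e_def of_nat_eq_iff_cong_CHAR)
  qed simp
  then show ?thesis
    by (simp add: line_in_envelope_def eval3_renitent_envelope)
qed

text \<open>A contained pencil would make the envelope vanish at all lines through the direction.
  Sharpness gives exactly \<open>n\<close> nodes, so the determinant is nonzero at any line whose
  value is not a node.\<close>

lemma sharp_pencil_not_in_envelope:
  fixes T :: "('a::{field,finite} \<times> 'a) multiset"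
  assumes p: "CHAR('a) = p" and n: "2 * n < CARD('a)"
    and "sharply_uniform_direction p T (int n) d"
  shows "\<not> pencil_in_envelope (dir_coords d) (renitent_envelope n T)"
proof
  assume "pencil_in_envelope (dir_coords d) (renitent_envelope n T)"
  then obtain h where h: "renitent_envelope n T = pencil_form (dir_coords d) * h"
    by (auto simp: pencil_in_envelope_def)
  obtain t where t: "int (card (lines_meeting p T d t)) = int CARD('a) - int n"
    using assms by (auto simp: sharply_uniform_direction_def)
  obtain u v where uv: "(u, v) \<noteq> (0, 0)" "incident (dir_coords d) (u, v, 0)"
    by (rule moment_form_cong_pencil[of d T])
  define e where "e c = of_nat (inter_size T (affine_line (u, v, - c))) - (of_nat t :: 'a)" for c
  have card: "card {c. e c \<noteq> 0} = n"
    using t card_atypical_add_card_lines_meeting[OF p uv, of T t] by (simp add: e_def)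
  \<comment> \<open>There are only \<open>n\<close> nodes and \<open>n\<close> is less than the
    field order, so a typical line exists.\<close>
  then have "{c. e c \<noteq> 0} \<noteq> UNIV"
    using n by auto
  then obtain x where x: "x \<notin> {c. e c \<noteq> 0}"
    by blast
  have "det (hankel_bordered n (moment T u v) x) \<noteq> 0"
  proof (rule det_hankel_bordered_neq_0[OF _ card])
    show "moment T u v k = (\<Sum>c | e c \<noteq> 0. e c * c ^ k)" if "k < 2 * n" for k
      using moment_eq_weighted_power_sum[of k T u v t] n that by (simp add: e_def)
  qed (use x in auto)
  moreover interpret comm_ring_hom "\<lambda>g. eval3 g (u, v, - x)"
    by (rule eval3_hom)
  have "eval3 (pencil_form (dir_coords d)) (u, v, - x) = 0"
    using line_in_pencil_iff[of "(u, v, - x)" "dir_coords d"] uv(2)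
      incident_dir_coords_cong[of d u v 0 "- x"]
    by (simp add: line_in_envelope_def)
  then have "eval3 (renitent_envelope n T) (u, v, - x) = 0"
    by (simp add: h hom_mult)
  ultimately show False
    by (simp add: eval3_renitent_envelope)
qed

theorem theorem3p3:
  fixes p h lam :: nat
    and T :: "('a::{field,finite} \<times> 'a) multiset"
    and E :: "'a direction set"
  assumes "prime p" and "CARD('a) = p ^ h"
    and "0 < lam" and "real lam \<le> (real CARD('a) - 1) / 2"
    and "\<forall>d\<in>E. uniform_direction p T (int lam) d"
    and "card E \<le> CARD('a)"
    and "\<exists>d\<in>E. sharply_uniform_direction p T (int lam) d"
  shows "\<exists>g :: 'a poly3. algebraic_envelope (lam ^ 2) g \<and>
    (\<forall>d\<in>E. \<forall>u v w. (u, v) \<noteq> (0, 0) \<and> renitent_line p T (int lam) d (affine_line (u, v, w)) \<longrightarrow>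
        line_in_envelope (u, v, w) g) \<and>
    (\<forall>d\<in>E. \<forall>mu::nat. mu < lam \<and> uniform_direction p T (int mu) d \<longrightarrow>
        pencil_in_envelope_mult (lam - mu) (dir_coords d) g) \<and>
    (\<forall>d. sharply_uniform_direction p T (int lam) d \<longrightarrow>
        \<not> pencil_in_envelope (dir_coords d) g)"
proof -
  let ?g = "renitent_envelope lam T"
  have p: "CHAR('a) = p"
    using assms(1,2) by (rule CHAR_eq_if_CARD_prime_power)
  have "real (2 * lam) < real CARD('a)"
    using assms(4) by (simp add: field_simps)
  \<comment> \<open>This keeps all exponents up to \<open>2 * lam - 1\<close> within the range where
    the power sums over the whole field vanish.\<close>
  then have n: "2 * lam < CARD('a)"
    by linarith
  have not_in: "\<not> pencil_in_envelope (dir_coords d) ?g"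
    if "sharply_uniform_direction p T (int lam) d" for d
    using sharp_pencil_not_in_envelope[OF p n that] .
  \<comment> \<open>Every form divides 0, so one pencil that is not contained already rules out the
    zero polynomial.\<close>
  then have "?g \<noteq> 0"
    using assms(7) by (auto simp: pencil_in_envelope_def)
  then have "algebraic_envelope (lam ^ 2) ?g"
    by (simp add: algebraic_envelope_def homogeneous3_renitent_envelope)
  then show ?thesis
    by (intro exI[of _ ?g] conjI ballI allI impI; (elim conjE)?)
      (simp_all add: not_in renitent_line_in_envelope[OF p n] pencil_power_dvd_renitent_envelope[OF p n])
qed

end
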